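(* Consider a $\phi$-irreducible Metropolis-within-Gibbs Markov chain on an open set $\mathcal{X}\subseteq\mathbf{R}^d$, with stationary distribution $\pi$. Suppose that from any initial state $x\in\mathcal{X}$, with probability $1$, the chain will eventually move (i.e., have a proposal accepted) at least once in each of the $d$ coordinate directions. Then the chain is Harris recurrent.
   Context: Metropolis-within-Gibbs chain: $\mathcal{X}$ is an open subset of $\mathbf{R}^d$ with Borel $\sigma$-algebra $\mathcal{F}$, and $f:\mathcal{X}\to(0,\infty)$ satisfies $\int_{\mathcal{X}}f\,d\lambda<\infty$, $\lambda$ being $d$-dimensional Lebesgue measure. The target distribution is $\pi(A)=\int_A f\,d\lambda/\int_{\mathcal{X}}f\,d\lambda$. For $1\le i\le d$, $q_i:\mathcal{X}\times\mathbf{R}\to[0,\infty)$ is jointly measurable with $\int_{-\infty}^{\infty}q_i(x,z)\,dz=1$ for all $x\in\mathcal{X}$. $Q_i(x,\cdot)$ is the Markov kernel to $\mathbf{R}^d$ which replaces the $i$th coordinate of $x$ by a draw from the density $q_i(x,\cdot)$ and leaves the other coordinates unchanged. It is assumed that $Q_i(x,\mathcal{X})>0$ for all $x\in\mathcal{X}$ and all $i$, and that each $q_i$ is symmetrically positive: $q_i((x_1,\dots,x_{i-1},y,x_{i+1},\dots,x_d),z)>0$ if and only if $q_i((x_1,\dots,x_{i-1},z,x_{i+1},\dots,x_d),y)>0$ (for both points in $\mathcal{X}$). For $x,y\in\mathcal{X}$ differing only in coordinate $i$, $\alpha_i(x,y)=\min\left[1,\frac{f(y)q_i(y,x_i)}{f(x)q_i(x,y_i)}\right]$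 (equal to $1$ if $f(x)q_i(x,y_i)=0$); proposals outside $\mathcal{X}$ are always rejected ($f=0$ there). The kernel $P_i$: from $X_n$, propose $Y_{n+1}\sim Q_i(X_n,\cdot)$; with probability $\alpha_i(X_n,Y_{n+1})$ accept and set $X_{n+1}=Y_{n+1}$ (a "move in the $i$th coordinate direction"), otherwise set $X_{n+1}=X_n$. The chain: random variables $I_1,I_2,\dots\in\{1,\dots,d\}$ are chosen according to some scheme (most commonly random-scan, $\{I_n\}$ i.i.d. uniform, or deterministic-scan, $I_1=1,\dots,I_d=d,I_{d+1}=1,\dots$), and given $X_n$, $X_{n+1}\sim P_{I_{n+1}}(X_n,\cdot)$. The scheme is such that this is a time-homogeneous Markov chain with stationary distribution $\pi$ (for the deterministic scan, the chain is observed after complete sweeps, with kernel $P_1P_2\cdots P_d$). For $A\in\mathcal{F}$, $\tau_A=\inf\{n\ge1:X_n\in A\}$ ($\infty$ if never). A chain is $\phi$-irreducible if there is a nonzero $\sigma$-finite measure $\psi$ on $(\mathcal{X},\mathcal{F})$ with $\mathbf{P}[\tau_A<\infty\mid X_0=x]>0$ for all $x\in\mathcal{X}$ and all $A\in\mathcal{F}$ with $\psi(A)>0$. A $\phi$-irreducible chain with stationary distribution $\pi$ is Harris recurrent if $\mathbf{P}(\tau_A<\infty\mid X_0=x)=1$ for all $A\in\mathcal{F}$ with $\pi(A)>0$ and all $x\in\mathcal{X}$. *)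

theory Defs
  imports "HOL-Probability.Probability"
begin

section \<open>Conditional laws and Markov chains on a general state space\<close>

text \<open>
  \<open>cond_law M H MH Y MY \<kappa>\<close>: under the law \<open>M\<close>, the conditional distribution of \<open>Y\<close> given \<open>H\<close>
  is \<open>\<kappa> H\<close>.
\<close>

definition cond_law ::
  "'w measure \<Rightarrow> ('w \<Rightarrow> 'h) \<Rightarrow> 'h measure \<Rightarrow> ('w \<Rightarrow> 'y) \<Rightarrow> 'y measure \<Rightarrow> ('h \<Rightarrow> 'y measure) \<Rightarrow> bool"
  where
  "cond_law M H MH Y MY \<kappa> \<longleftrightarrow>
     H \<in> M \<rightarrow>\<^sub>M MH \<and> Y \<in> M \<rightarrow>\<^sub>M MY \<and>
     (\<forall>E\<in>sets MH. \<forall>C\<in>sets MY.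
        emeasure M {w \<in> space M. H w \<in> E \<and> Y w \<in> C} =
        (\<integral>\<^sup>+w. indicator E (H w) * emeasure (\<kappa> (H w)) C \<partial>M))"

text \<open>
  A chain is given by random variables \<open>Z n\<close> together with a family of laws \<open>M x\<close>, where \<open>M x\<close>
  plays the role of the probability given that the chain starts at \<open>x\<close>. The transition kernel
  \<open>K\<close> is the same for all times and all starting points.
\<close>

definition markov_chain ::
  "'a measure \<Rightarrow> ('a \<Rightarrow> 'a measure) \<Rightarrow> ('a \<Rightarrow> 'w measure) \<Rightarrow> (nat \<Rightarrow> 'w \<Rightarrow> 'a) \<Rightarrow> bool" where
  "markov_chain S K M Z \<longleftrightarrow>
     K \<in> S \<rightarrow>\<^sub>M prob_algebra S \<and>
     (\<forall>x\<in>space S.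
        prob_space (M x) \<and>
        (\<forall>n. Z n \<in> M x \<rightarrow>\<^sub>M S) \<and>
        (AE w in M x. Z 0 w = x) \<and>
        (\<forall>n. cond_law (M x) (\<lambda>w. \<lambda>k\<in>{..n}. Z k w) (\<Pi>\<^sub>M k\<in>{..n}. S) (Z (Suc n)) S (\<lambda>h. K (h n))))"

definition stationary_distribution :: "'a measure \<Rightarrow> ('a \<Rightarrow> 'a measure) \<Rightarrow> 'a measure \<Rightarrow> bool" where
  "stationary_distribution S K \<pi> \<longleftrightarrow>
     prob_space \<pi> \<and> sets \<pi> = sets S \<and>
     (\<forall>A\<in>sets S. (\<integral>\<^sup>+x. emeasure (K x) A \<partial>\<pi>) = emeasure \<pi> A)"

definition hitting_time :: "(nat \<Rightarrow> 'w \<Rightarrow> 'a) \<Rightarrow> 'a set \<Rightarrow> 'w \<Rightarrow> enat" where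
  "hitting_time Z A w = Inf {enat n | n. 1 \<le> n \<and> Z n w \<in> A}"

definition hit_prob :: "('a \<Rightarrow> 'w measure) \<Rightarrow> (nat \<Rightarrow> 'w \<Rightarrow> 'a) \<Rightarrow> 'a set \<Rightarrow> 'a \<Rightarrow> real" where
  "hit_prob M Z A x = measure (M x) {w \<in> space (M x). hitting_time Z A w < \<infinity>}"

definition phi_irreducible ::
  "'a measure \<Rightarrow> ('a \<Rightarrow> 'w measure) \<Rightarrow> (nat \<Rightarrow> 'w \<Rightarrow> 'a) \<Rightarrow> bool" where
  "phi_irreducible S M Z \<longleftrightarrow>
     (\<exists>\<psi>. sigma_finite_measure \<psi> \<and> sets \<psi> = sets S \<and> emeasure \<psi> (space \<psi>) \<noteq> 0 \<and>
          (\<forall>x\<in>space S. \<forall>A\<in>sets S. emeasure \<psi> A > 0 \<longrightarrow> hit_prob M Z A x > 0))"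

definition harris_recurrent ::
  "'a measure \<Rightarrow> 'a measure \<Rightarrow> ('a \<Rightarrow> 'w measure) \<Rightarrow> (nat \<Rightarrow> 'w \<Rightarrow> 'a) \<Rightarrow> bool" where
  "harris_recurrent S \<pi> M Z \<longleftrightarrow>
     (\<forall>A\<in>sets S. emeasure \<pi> A > 0 \<longrightarrow> (\<forall>x\<in>space S. hit_prob M Z A x = 1))"

section \<open>Metropolis-within-Gibbs\<close>

text \<open>
  The state space is a set \<open>\<X>\<close> of vectors in \<open>real ^ 'n\<close>; the density \<open>f\<close> and the proposal
  densities \<open>q i\<close> are total functions of which only the values at points of \<open>\<X>\<close> matter.
\<close>

abbreviation states :: "(real ^ 'n) set \<Rightarrow> (real ^ 'n) measure" where
  "states \<X> \<equiv> restrict_space borel \<X>"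

definition target :: "(real ^ 'n) set \<Rightarrow> (real ^ 'n \<Rightarrow> real) \<Rightarrow> (real ^ 'n) measure" where
  "target \<X> f =
     density (restrict_space lborel \<X>) (\<lambda>x. ennreal (f x / (LINT y:\<X>|lborel. f y)))"

definition upd :: "'n \<Rightarrow> real ^ 'n \<Rightarrow> real \<Rightarrow> real ^ 'n" where
  "upd i x z = (\<chi> j. if j = i then z else x $ j)"

definition proposal ::
  "('n \<Rightarrow> real ^ 'n \<Rightarrow> real \<Rightarrow> real) \<Rightarrow> 'n \<Rightarrow> real ^ 'n \<Rightarrow> (real ^ 'n) measure" where
  "proposal q i x = distr (density lborel (\<lambda>z. ennreal (q i x z))) borel (upd i x)"

definition accept_prob ::
  "(real ^ 'n) set \<Rightarrow> (real ^ 'n \<Rightarrow> real) \<Rightarrow> ('n \<Rightarrow> real ^ 'n \<Rightarrow> real \<Rightarrow> real) \<Rightarrow>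
   'n \<Rightarrow> real ^ 'n \<Rightarrow> real ^ 'n \<Rightarrow> real" where
  "accept_prob \<X> f q i x y =
     (if y \<notin> \<X> then 0
      else if f x * q i x (y $ i) = 0 then 1
      else min 1 ((f y * q i y (x $ i)) / (f x * q i x (y $ i))))"

text \<open>
  Joint law of the proposal \<open>y\<close> made from \<open>x\<close> in direction \<open>i\<close> and of the flag telling whether it
  is accepted.
\<close>

definition propose_accept ::
  "(real ^ 'n) set \<Rightarrow> (real ^ 'n \<Rightarrow> real) \<Rightarrow> ('n \<Rightarrow> real ^ 'n \<Rightarrow> real \<Rightarrow> real) \<Rightarrow>
   'n \<Rightarrow> real ^ 'n \<Rightarrow> ((real ^ 'n) \<times> bool) measure" where
  "propose_accept \<X> f q i x =
     proposal q i x \<bind>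
       (\<lambda>y. distr (measure_pmf (bernoulli_pmf (accept_prob \<X> f q i x y)))
                  (borel \<Otimes>\<^sub>M count_space UNIV) (\<lambda>b. (y, b)))"

definition mwg_setting ::
  "(real ^ 'n) set \<Rightarrow> (real ^ 'n \<Rightarrow> real) \<Rightarrow> ('n \<Rightarrow> real ^ 'n \<Rightarrow> real \<Rightarrow> real) \<Rightarrow> bool" where
  "mwg_setting \<X> f q \<longleftrightarrow>
     open \<X> \<and>
     (\<forall>x\<in>\<X>. 0 < f x) \<and> set_integrable lborel \<X> f \<and>
     (\<forall>i. (\<lambda>(x, z). q i x z) \<in> borel_measurable (states \<X> \<Otimes>\<^sub>M borel)) \<and>
     (\<forall>i. \<forall>x\<in>\<X>. \<forall>z. 0 \<le> q i x z) \<and>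
     (\<forall>i. \<forall>x\<in>\<X>. (\<integral>\<^sup>+z. ennreal (q i x z) \<partial>lborel) = 1) \<and>
     (\<forall>i. \<forall>x\<in>\<X>. 0 < emeasure (proposal q i x) \<X>) \<and>
     (\<forall>i. \<forall>x\<in>\<X>. \<forall>z. upd i x z \<in> \<X> \<longrightarrow> (0 < q i x z \<longleftrightarrow> 0 < q i (upd i x z) (x $ i)))"

text \<open>
  The step from time \<open>n\<close> to time \<open>n + 1\<close> uses the coordinate \<open>I (n + 1)\<close>, the proposal \<open>Y (n + 1)\<close>
  and the acceptance flag \<open>acc (n + 1)\<close>; the values of these variables at index 0 play no role.
  Nothing is required of the scheme generating the coordinates: \<open>I (n + 1)\<close> only enters as part of
  the information on which the law of the next proposal is conditioned. The resulting conditional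
  law of \<open>X (n + 1)\<close> is the Metropolis kernel for coordinate \<open>I (n + 1)\<close> started at \<open>X n\<close>.
\<close>

definition mwg_process ::
  "(real ^ 'n) set \<Rightarrow> (real ^ 'n \<Rightarrow> real) \<Rightarrow> ('n \<Rightarrow> real ^ 'n \<Rightarrow> real \<Rightarrow> real) \<Rightarrow>
   (real ^ 'n \<Rightarrow> 'w measure) \<Rightarrow> (nat \<Rightarrow> 'w \<Rightarrow> real ^ 'n) \<Rightarrow> (nat \<Rightarrow> 'w \<Rightarrow> 'n) \<Rightarrow>
   (nat \<Rightarrow> 'w \<Rightarrow> real ^ 'n) \<Rightarrow> (nat \<Rightarrow> 'w \<Rightarrow> bool) \<Rightarrow> bool" where
  "mwg_process \<X> f q M X I Y acc \<longleftrightarrow>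
     (\<forall>x\<in>\<X>.
        prob_space (M x) \<and>
        (AE w in M x. X 0 w = x) \<and>
        (\<forall>n. cond_law (M x)
               (\<lambda>w. (\<lambda>k\<in>{..n}. X k w, \<lambda>k\<in>{1..n}. (Y k w, acc k w), \<lambda>k\<in>{1..Suc n}. I k w))
               ((\<Pi>\<^sub>M k\<in>{..n}. states \<X>) \<Otimes>\<^sub>M
                (\<Pi>\<^sub>M k\<in>{1..n}. borel \<Otimes>\<^sub>M count_space UNIV) \<Otimes>\<^sub>M
                (\<Pi>\<^sub>M k\<in>{1..Suc n}. count_space UNIV))
               (\<lambda>w. (Y (Suc n) w, acc (Suc n) w))
               (borel \<Otimes>\<^sub>M count_space UNIV)
               (\<lambda>(xs, ys, is). propose_accept \<X> f q (is (Suc n)) (xs n))) \<and>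
        (\<forall>n. AE w in M x. X (Suc n) w = (if acc (Suc n) w then Y (Suc n) w else X n w)))"

definition moves_in_direction ::
  "(nat \<Rightarrow> 'w \<Rightarrow> 'n) \<Rightarrow> (nat \<Rightarrow> 'w \<Rightarrow> bool) \<Rightarrow> 'n \<Rightarrow> nat \<Rightarrow> 'w \<Rightarrow> bool" where
  "moves_in_direction I acc i n w \<longleftrightarrow> 1 \<le> n \<and> I n w = i \<and> acc n w"

end

theory Submission
  imports Defs
begin

text \<open>
  For \<open>\<pi>(A) > 0\<close> let \<open>g x\<close> be the probability, starting at \<open>x\<close>, of never being in \<open>A\<close> at any time
  \<open>n \<ge> 0\<close>. Then \<open>g \<le> K g\<close>, and since \<open>\<pi>\<close> is stationary equality holds \<open>\<pi>\<close>-almost everywhere. So the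
  set \<open>{g = 0} \<supseteq> A\<close> cannot be left, and again by stationarity it cannot be entered from its complement
  either; irreducibility then forces \<open>g = 0\<close> almost everywhere. Consequently the chain is Harris
  recurrent as soon as it leaves every \<open>\<pi>\<close>-null set almost surely from every starting point. For the
  Metropolis-within-Gibbs chain this holds because, once a move has been made in each coordinate
  direction, the law of the state is absolutely continuous with respect to Lebesgue measure.
\<close>

section \<open>Escaping null sets implies Harris recurrence\<close>

text \<open>\<open>cond_law\<close> only speaks about events. Restricting \<open>M\<close> to the
  event that \<open>H\<close> lies in \<open>E\<close> gives \<open>?D\<close>, and the law of
  \<open>Y\<close> under \<open>?D\<close> is then the mixture of the measures
  \<open>\<kappa> (H w)\<close>; integrating against a mixture is iterated integration.
  Measurability is asked of the composite with \<open>H\<close>, so that \<open>\<kappa>\<close> may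
  be arbitrary off the range of \<open>H\<close>.\<close>

lemma cond_law_nn_integral:
  assumes "cond_law M H MH Y MY \<kappa>" and "prob_space M"
    and \<kappa>: "(\<lambda>w. \<kappa> (H w)) \<in> M \<rightarrow>\<^sub>M subprob_algebra MY"
    and E: "E \<in> sets MH" and \<phi>[measurable]: "\<phi> \<in> borel_measurable MY"
  shows "(\<integral>\<^sup>+w. indicator E (H w) * \<phi> (Y w) \<partial>M) =
         (\<integral>\<^sup>+w. indicator E (H w) * (\<integral>\<^sup>+y. \<phi> y \<partial>\<kappa> (H w)) \<partial>M)"
proof -
  interpret prob_space M by fact
  have [measurable]: "H \<in> M \<rightarrow>\<^sub>M MH" "Y \<in> M \<rightarrow>\<^sub>M MY" "E \<in> sets MH"
    using assms by (auto simp: cond_law_def)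
  have law: "emeasure M {w \<in> space M. H w \<in> E \<and> Y w \<in> C} =
        (\<integral>\<^sup>+w. indicator E (H w) * emeasure (\<kappa> (H w)) C \<partial>M)" if "C \<in> sets MY" for C
    using assms(1) E that by (auto simp: cond_law_def)
  note \<kappa>[measurable]
  let ?D = "density M (\<lambda>w. indicator E (H w))"
  have \<kappa>D: "(\<lambda>w. \<kappa> (H w)) \<in> ?D \<rightarrow>\<^sub>M subprob_algebra MY"
    using \<kappa> by (simp cong: measurable_cong_sets)
  have ne: "space ?D \<noteq> {}"
    by (simp add: not_empty)
  have sb: "sets (?D \<bind> (\<lambda>w. \<kappa> (H w))) = sets MY"
    using sets_kernel[OF \<kappa>D] ne by (intro sets_bind) auto
  have "distr ?D MY Y = ?D \<bind> (\<lambda>w. \<kappa> (H w))"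
  proof (rule measure_eqI)
    show "sets (distr ?D MY Y) = sets (?D \<bind> (\<lambda>w. \<kappa> (H w)))"
      using sb by simp
    fix C assume "C \<in> sets (distr ?D MY Y)"
    then have C[measurable]: "C \<in> sets MY" by simp
    have "emeasure (distr ?D MY Y) C = emeasure ?D (Y -` C \<inter> space M)"
      by (subst emeasure_distr) (auto cong: measurable_cong_sets)
    also have "\<dots> = (\<integral>\<^sup>+w. indicator E (H w) * indicator (Y -` C \<inter> space M) w \<partial>M)"
      by (rule emeasure_density) measurable
    also have "\<dots> = (\<integral>\<^sup>+w. indicator {w \<in> space M. H w \<in> E \<and> Y w \<in> C} w \<partial>M)"
      by (rule nn_integral_cong) (auto split: split_indicator)
    also have "\<dots> = emeasure M {w \<in> space M. H w \<in> E \<and> Y w \<in> C}"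
      by (rule nn_integral_indicator) measurable
    also have "\<dots> = (\<integral>\<^sup>+w. indicator E (H w) * emeasure (\<kappa> (H w)) C \<partial>M)"
      by (rule law[OF C])
    also have "\<dots> = (\<integral>\<^sup>+w. emeasure (\<kappa> (H w)) C \<partial>?D)"
      by (subst nn_integral_density)
        (auto intro: measurable_compose[OF \<kappa> measurable_emeasure_subprob_algebra])
    also have "\<dots> = emeasure (?D \<bind> (\<lambda>w. \<kappa> (H w))) C"
      by (subst emeasure_bind[OF ne \<kappa>D C]) simp
    finally show "emeasure (distr ?D MY Y) C = emeasure (?D \<bind> (\<lambda>w. \<kappa> (H w))) C" .
  qed
  then have "(\<integral>\<^sup>+y. \<phi> y \<partial>distr ?D MY Y) = (\<integral>\<^sup>+y. \<phi> y \<partial>(?D \<bind> (\<lambda>w. \<kappa> (H w))))"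
    by simp
  also have "\<dots> = (\<integral>\<^sup>+w. (\<integral>\<^sup>+y. \<phi> y \<partial>\<kappa> (H w)) \<partial>?D)"
    by (rule nn_integral_bind[OF \<phi> \<kappa>D])
  finally show ?thesis
    by (simp add: nn_integral_distr nn_integral_density
        measurable_compose[OF \<kappa> nn_integral_measurable_subprob_algebra[OF \<phi>]] cong: measurable_cong_sets)
qed

text \<open>The one-step operator of the chain killed in \<open>A\<close>. The indicator tests the
  current point, so the \<open>n\<close>-th iterate gives the expectation of \<open>\<phi>\<close>
  at time \<open>n\<close> on the event that \<open>A\<close> is avoided at times \<open>0\<close>
  to \<open>n - 1\<close>. For \<open>A = {}\<close> it is the ordinary transition operator.\<close>

definition killed :: "('a \<Rightarrow> 'a measure) \<Rightarrow> 'a set \<Rightarrow> ('a \<Rightarrow> ennreal) \<Rightarrow> 'a \<Rightarrow> ennreal" where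
  "killed K A \<phi> x = indicator (- A) x * (\<integral>\<^sup>+y. \<phi> y \<partial>K x)"

section \<open>Taboo probabilities and stationarity for a general chain\<close>

locale stationary_chain =
  fixes S :: "'a measure" and K :: "'a \<Rightarrow> 'a measure" and M :: "'a \<Rightarrow> 'w measure"
    and Z :: "nat \<Rightarrow> 'w \<Rightarrow> 'a" and \<pi> :: "'a measure"
  assumes markov: "markov_chain S K M Z"
    and stationary: "stationary_distribution S K \<pi>"
    and irreducible: "phi_irreducible S M Z"
begin

lemma K_prob: "K \<in> S \<rightarrow>\<^sub>M prob_algebra S"
  using markov by (simp add: markov_chain_def)

lemma K_subprob[measurable]: "K \<in> S \<rightarrow>\<^sub>M subprob_algebra S"
  using K_prob by (rule measurable_prob_algebraD)

lemma sets_K: "x \<in> space S \<Longrightarrow> sets (K x) = sets S"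
  using K_subprob by (rule sets_kernel)

lemma prob_space_K: "x \<in> space S \<Longrightarrow> prob_space (K x)"
  using measurable_space[OF K_prob] by (simp add: space_prob_algebra)

lemma space_K: "x \<in> space S \<Longrightarrow> space (K x) = space S"
  using sets_K by (metis sets_eq_imp_space_eq)

lemma prob_space_M: "x \<in> space S \<Longrightarrow> prob_space (M x)"
  using markov by (simp add: markov_chain_def)

lemma Z_measurable: "x \<in> space S \<Longrightarrow> Z n \<in> M x \<rightarrow>\<^sub>M S"
  using markov by (simp add: markov_chain_def)

lemma Z_0: "x \<in> space S \<Longrightarrow> AE w in M x. Z 0 w = x"
  using markov by (simp add: markov_chain_def)

lemma prob_space_pi: "prob_space \<pi>"
  using stationary by (simp add: stationary_distribution_def)

lemma sets_pi[measurable_cong, simp]: "sets \<pi> = sets S"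
  using stationary by (simp add: stationary_distribution_def)

lemma space_pi[simp]: "space \<pi> = space S"
  using sets_pi by (rule sets_eq_imp_space_eq)

lemma integral_K_measurable:
  assumes "\<phi> \<in> borel_measurable S"
  shows "(\<lambda>x. \<integral>\<^sup>+y. \<phi> y \<partial>K x) \<in> borel_measurable S"
  by (rule measurable_compose[OF K_subprob nn_integral_measurable_subprob_algebra[OF assms]])

lemma killed_measurable:
  assumes [measurable]: "A \<in> sets S" "\<phi> \<in> borel_measurable S"
  shows "killed K A \<phi> \<in> borel_measurable S"
proof -
  note integral_K_measurable[measurable]
  have "(\<lambda>x. indicator (space S - A) x * (\<integral>\<^sup>+y. \<phi> y \<partial>K x)) \<in> borel_measurable S"
    by measurable
  then show ?thesis
    by (rule measurable_cong[THEN iffD1, rotated]) (auto simp: killed_def indicator_def)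
qed

lemma killed_funpow_measurable:
  "A \<in> sets S \<Longrightarrow> \<phi> \<in> borel_measurable S \<Longrightarrow> (killed K A ^^ n) \<phi> \<in> borel_measurable S"
  by (induction n) (auto intro: killed_measurable)

lemma nn_integral_stationary:
  assumes \<phi>: "\<phi> \<in> borel_measurable S"
  shows "(\<integral>\<^sup>+x. (\<integral>\<^sup>+y. \<phi> y \<partial>K x) \<partial>\<pi>) = (\<integral>\<^sup>+x. \<phi> x \<partial>\<pi>)"
proof -
  interpret prob_space \<pi> by (rule prob_space_pi)
  have K\<pi>: "K \<in> \<pi> \<rightarrow>\<^sub>M subprob_algebra S"
    using K_subprob by (simp cong: measurable_cong_sets)
  have sb: "sets (\<pi> \<bind> K) = sets S"
    using sets_K not_empty by (intro sets_bind) auto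
  have "\<pi> \<bind> K = \<pi>"
  proof (rule measure_eqI)
    fix A assume "A \<in> sets (\<pi> \<bind> K)"
    then have A: "A \<in> sets S" using sb by simp
    then show "emeasure (\<pi> \<bind> K) A = emeasure \<pi> A"
      using emeasure_bind[OF not_empty K\<pi> A] stationary by (simp add: stationary_distribution_def)
  qed (simp add: sb)
  then show ?thesis
    using nn_integral_bind[OF \<phi> K\<pi>] by simp
qed

text \<open>The Markov property at time \<open>k\<close>. The induction peels off the last step:
  conditioning on the history up to \<open>k + n\<close> replaces \<open>\<phi>\<close> by
  \<open>killed K A \<phi>\<close> one time unit earlier, which is why \<open>\<phi>\<close> is
  generalised.\<close>

lemma nn_integral_killed:
  assumes x: "x \<in> space S" and [measurable]: "A \<in> sets S" "B \<in> sets S" "\<phi> \<in> borel_measurable S"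
  shows "(\<integral>\<^sup>+w. indicator {w. Z k w \<in> B \<and> (\<forall>j\<in>{k..<k+n}. Z j w \<notin> A)} w * \<phi> (Z (k + n) w) \<partial>M x) =
         (\<integral>\<^sup>+w. indicator B (Z k w) * (killed K A ^^ n) \<phi> (Z k w) \<partial>M x)"
  using assms(4)
proof (induction n arbitrary: \<phi>)
  case 0
  then show ?case by (auto intro!: nn_integral_cong simp: indicator_def)
next
  case (Suc n)
  note [measurable] = Suc.prems
  \<comment> \<open>The event becomes a product set of histories: times before \<open>k\<close> are
    unconstrained, time \<open>k\<close> lies in \<open>B\<close>, and all times from
    \<open>k\<close> on avoid \<open>A\<close>.\<close>
  define C where "C j = (if j = k then B else space S) \<inter> (if k \<le> j then space S - A else space S)" for j
  have C[measurable]: "C j \<in> sets S" for j by (simp add: C_def)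
  let ?H = "\<lambda>w. \<lambda>j\<in>{..k+n}. Z j w"
  let ?E = "Pi\<^sub>E {..k+n} C"
  have Zs: "Z j w \<in> space S" if "w \<in> space (M x)" for j w
    using measurable_space[OF Z_measurable[OF x] that] .
  have E: "?E \<in> sets (\<Pi>\<^sub>M j\<in>{..k+n}. S)"
    by (intro sets_PiM_I_finite) auto
  have H: "(?H w \<in> ?E) = (Z k w \<in> B \<and> (\<forall>j\<in>{k..<k + Suc n}. Z j w \<notin> A))" if "w \<in> space (M x)" for w
    using Zs[OF that] by (auto simp: C_def PiE_iff split: if_splits)
  have law: "cond_law (M x) ?H (\<Pi>\<^sub>M j\<in>{..k+n}. S) (Z (Suc (k+n))) S (\<lambda>h. K (h (k+n)))"
    using markov x by (simp add: markov_chain_def)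
  have "(\<integral>\<^sup>+w. indicator {w. Z k w \<in> B \<and> (\<forall>j\<in>{k..<k+Suc n}. Z j w \<notin> A)} w * \<phi> (Z (k + Suc n) w) \<partial>M x)
      = (\<integral>\<^sup>+w. indicator ?E (?H w) * \<phi> (Z (Suc (k + n)) w) \<partial>M x)"
    using H by (intro nn_integral_cong) (auto simp: indicator_def)
  also have "\<dots> = (\<integral>\<^sup>+w. indicator ?E (?H w) * (\<integral>\<^sup>+y. \<phi> y \<partial>K (?H w (k+n))) \<partial>M x)"
  proof (rule cond_law_nn_integral[OF law prob_space_M[OF x] _ E Suc.prems])
    show "(\<lambda>w. K (?H w (k+n))) \<in> M x \<rightarrow>\<^sub>M subprob_algebra S"
      using measurable_compose[OF Z_measurable[OF x] K_subprob] by simp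
  qed
  \<comment> \<open>The indicator inside \<open>killed\<close> absorbs the condition at time
    \<open>k + n\<close>, so the taboo window shrinks by one.\<close>
  also have "\<dots> = (\<integral>\<^sup>+w. indicator {w. Z k w \<in> B \<and> (\<forall>j\<in>{k..<k+n}. Z j w \<notin> A)} w
        * killed K A \<phi> (Z (k + n) w) \<partial>M x)"
    using H by (intro nn_integral_cong) (auto simp: indicator_def killed_def less_Suc_eq)
  also have "\<dots> = (\<integral>\<^sup>+w. indicator B (Z k w) * (killed K A ^^ n) (killed K A \<phi>) (Z k w) \<partial>M x)"
    by (intro Suc.IH killed_measurable) measurable
  finally show ?case
    by (simp add: funpow_swap1)
qed

lemma emeasure_Z_eq:
  assumes x: "x \<in> space S" and A[measurable]: "A \<in> sets S"
  shows "emeasure (M x) {w \<in> space (M x). Z n w \<in> A} = (killed K {} ^^ n) (indicator A) x"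
proof -
  interpret prob_space "M x" by (rule prob_space_M[OF x])
  note Z_measurable[OF x, measurable]
  have Zs: "Z j w \<in> space S" if "w \<in> space (M x)" for j w
    using measurable_space[OF Z_measurable[OF x] that] .
  have "emeasure (M x) {w \<in> space (M x). Z n w \<in> A} =
      (\<integral>\<^sup>+w. indicator {w \<in> space (M x). Z n w \<in> A} w \<partial>M x)"
    by (rule nn_integral_indicator[symmetric]) measurable
  also have "\<dots> = (\<integral>\<^sup>+w. indicator {w. Z 0 w \<in> space S \<and> (\<forall>j\<in>{0..<0+n}. Z j w \<notin> {})} w
        * indicator A (Z (0 + n) w) \<partial>M x)"
    using Zs by (intro nn_integral_cong) (auto simp: indicator_def)
  also have "\<dots> = (\<integral>\<^sup>+w. indicator (space S) (Z 0 w) * (killed K {} ^^ n) (indicator A) (Z 0 w) \<partial>M x)"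
    by (rule nn_integral_killed[OF x]) auto
  also have "\<dots> = (\<integral>\<^sup>+w. (killed K {} ^^ n) (indicator A) x \<partial>M x)"
    using Z_0[OF x] x by (intro nn_integral_cong_AE) auto
  finally show ?thesis
    by (simp add: emeasure_space_1)
qed

lemma hitting_time_finite_iff: "hitting_time Z A w < \<infinity> \<longleftrightarrow> (\<exists>n\<ge>1. Z n w \<in> A)"
proof
  assume "\<exists>n\<ge>1. Z n w \<in> A"
  then obtain n where "1 \<le> n" "Z n w \<in> A" by blast
  then have "hitting_time Z A w \<le> enat n"
    unfolding hitting_time_def by (intro Inf_lower) auto
  then show "hitting_time Z A w < \<infinity>"
    by (metis enat_ord_simps(4) le_less_trans not_infinity_eq)
next
  assume "hitting_time Z A w < \<infinity>"
  then show "\<exists>n\<ge>1. Z n w \<in> A"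
    unfolding hitting_time_def Inf_enat_def by (auto split: if_splits)
qed

lemma hit_prob_eq_0:
  assumes x: "x \<in> space S" and A[measurable]: "A \<in> sets S"
    and 0: "\<And>n. (killed K {} ^^ n) (indicator A) x = 0"
  shows "hit_prob M Z A x = 0"
proof -
  interpret prob_space "M x" by (rule prob_space_M[OF x])
  note Z_measurable[OF x, measurable]
  have "AE w in M x. Z n w \<notin> A" for n
  proof (rule AE_I)
    show "emeasure (M x) {w \<in> space (M x). Z n w \<in> A} = 0"
      using emeasure_Z_eq[OF x A, of n] 0 by simp
    show "{w \<in> space (M x). Z n w \<in> A} \<in> events" by measurable
  qed auto
  then have "AE w in M x. \<forall>n. Z n w \<notin> A"
    unfolding AE_all_countable by blast
  then have "AE w in M x. \<not> (\<exists>n\<ge>1. Z n w \<in> A)"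
    by eventually_elim blast
  moreover have "{w \<in> space (M x). \<exists>n\<ge>1. Z n w \<in> A} \<in> events" by measurable
  ultimately show ?thesis
    unfolding hit_prob_def hitting_time_finite_iff by (subst prob_Collect_eq_0) auto
qed

text \<open>By stationarity, the average under \<open>\<pi>\<close> of the mass that
  \<open>K x\<close> gives to an exceptional set is the \<open>\<pi>\<close>-measure of that set,
  hence zero.\<close>

lemma AE_null_K:
  assumes "AE x in \<pi>. P x" and [measurable]: "Measurable.pred S P"
  shows "AE x in \<pi>. AE y in K x. P y"
proof -
  let ?N = "{x \<in> space S. \<not> P x}"
  have N: "?N \<in> sets S" by measurable
  have "emeasure \<pi> ?N = 0"
    using assms(1) by (subst (asm) AE_iff_measurable[of ?N]) auto
  then have "(\<integral>\<^sup>+x. emeasure (K x) ?N \<partial>\<pi>) = 0"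
    using stationary N by (simp add: stationary_distribution_def)
  then have "AE x in \<pi>. emeasure (K x) ?N = 0"
    using measurable_compose[OF K_subprob measurable_emeasure_subprob_algebra[OF N]]
    by (subst (asm) nn_integral_0_iff_AE) (auto cong: measurable_cong_sets)
  moreover have "AE x in \<pi>. x \<in> space S"
    using AE_space[of \<pi>] by simp
  ultimately show ?thesis
  proof eventually_elim
    case (elim x)
    then show ?case
      using N by (subst AE_iff_measurable[of ?N]) (auto simp: sets_K space_K)
  qed
qed

text \<open>A step from almost every point outside \<open>B\<close> stays outside \<open>B\<close>,
  and by \<open>AE_null_K\<close> it also misses the null set where the induction hypothesis
  fails.\<close>

lemma unreachable_funpow:
  assumes B[measurable]: "B \<in> sets S" and B0: "AE x in \<pi>. x \<notin> B \<longrightarrow> emeasure (K x) B = 0"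
  shows "AE x in \<pi>. x \<notin> B \<longrightarrow> (killed K {} ^^ n) (indicator B) x = 0"
proof (induction n)
  case 0
  show ?case by (auto simp: indicator_def)
next
  case (Suc n)
  let ?\<phi> = "(killed K {} ^^ n) (indicator B)"
  have [measurable]: "?\<phi> \<in> borel_measurable S"
    by (rule killed_funpow_measurable) auto
  have "AE x in \<pi>. AE y in K x. y \<notin> B \<longrightarrow> ?\<phi> y = 0"
    by (rule AE_null_K[OF Suc]) measurable
  moreover have "AE x in \<pi>. x \<in> space S"
    using AE_space[of \<pi>] by simp
  ultimately show ?case
    using B0
  proof eventually_elim
    case (elim x)
    show ?case
    proof
      assume x: "x \<notin> B"
      then have "AE y in K x. y \<notin> B"
        using elim B by (subst AE_iff_measurable[of B]) (use sets.sets_into_space[OF B] in \<open>auto simp: sets_K space_K\<close>)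
      with elim(1) have "AE y in K x. ?\<phi> y = 0"
        by eventually_elim auto
      then have "(\<integral>\<^sup>+y. ?\<phi> y \<partial>K x) = (\<integral>\<^sup>+y. 0 \<partial>K x)"
        by (rule nn_integral_cong_AE)
      then show "(killed K {} ^^ Suc n) (indicator B) x = 0"
        by (simp add: killed_def)
    qed
  qed
qed

text \<open>At almost every point outside \<open>B\<close> the probability of ever hitting
  \<open>B\<close> would be zero, contradicting positivity; hence almost no point lies
  outside.\<close>

lemma unreachable_imp_full:
  assumes \<psi>: "\<And>x. x \<in> space S \<Longrightarrow> hit_prob M Z B x > 0"
    and B: "B \<in> sets S" and B0: "AE x in \<pi>. x \<notin> B \<longrightarrow> emeasure (K x) B = 0"
  shows "AE x in \<pi>. x \<in> B"
proof -
  have "AE x in \<pi>. \<forall>n. x \<notin> B \<longrightarrow> (killed K {} ^^ n) (indicator B) x = 0"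
    unfolding AE_all_countable using unreachable_funpow[OF B B0] by blast
  moreover have "AE x in \<pi>. x \<in> space S"
    using AE_space[of \<pi>] by simp
  ultimately show ?thesis
  proof eventually_elim
    case (elim x)
    show ?case
    proof (rule ccontr)
      assume "x \<notin> B"
      then have "hit_prob M Z B x = 0"
        using elim by (intro hit_prob_eq_0 B) auto
      then show False using \<psi>[of x] elim by simp
    qed
  qed
qed

text \<open>On the state space the iterates decrease, so this is the probability of never being in
  \<open>A\<close>, expressed through the kernel alone. Time 0 counts here, in contrast to
  \<open>hitting_time\<close>; therefore the function vanishes on \<open>A\<close>.\<close>

definition avoid :: "'a set \<Rightarrow> 'a \<Rightarrow> ennreal" where
  "avoid A x = (INF n. (killed K A ^^ n) (\<lambda>_. 1) x)"

lemma avoid_measurable: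
  assumes "A \<in> sets S"
  shows "avoid A \<in> borel_measurable S"
proof -
  note killed_funpow_measurable[OF assms, measurable]
  show ?thesis unfolding avoid_def[abs_def] by measurable
qed

lemma killed_mono:
  assumes "\<And>y. y \<in> space S \<Longrightarrow> \<phi> y \<le> \<phi>' y" "x \<in> space S"
  shows "killed K A \<phi> x \<le> killed K A \<phi>' x"
  unfolding killed_def using assms by (intro mult_left_mono nn_integral_mono) (auto simp: space_K)

lemma killed_funpow_decseq:
  assumes "x \<in> space S"
  shows "decseq (\<lambda>n. (killed K A ^^ n) (\<lambda>_. 1) x)"
proof (rule decseq_SucI)
  fix n show "(killed K A ^^ Suc n) (\<lambda>_. 1) x \<le> (killed K A ^^ n) (\<lambda>_. 1) x"
    using assms
  proof (induction n arbitrary: x)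
    case 0
    then show ?case
      using prob_space.emeasure_space_1[OF prob_space_K[OF 0]] by (simp add: killed_def indicator_def)
  next
    case (Suc n)
    then show ?case
      unfolding funpow.simps(2) comp_apply by (intro killed_mono) auto
  qed
qed

lemma avoid_le_1: "x \<in> space S \<Longrightarrow> avoid A x \<le> 1"
  unfolding avoid_def by (rule INF_lower2[of 0]) auto

lemma avoid_in:
  assumes "x \<in> A"
  shows "avoid A x = 0"
proof -
  have "avoid A x \<le> (killed K A ^^ Suc 0) (\<lambda>_. 1) x"
    unfolding avoid_def by (rule INF_lower) simp
  also have "\<dots> = 0"
    using assms by (simp add: killed_def)
  finally show ?thesis by simp
qed

text \<open>The iterate \<open>n + 1\<close> is at most the \<open>K\<close>-average of the iterate
  \<open>n\<close>. The infimum passes under the integral because the iterates decrease from the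
  integrable constant 1.\<close>

lemma avoid_le:
  assumes A: "A \<in> sets S" and x: "x \<in> space S"
  shows "avoid A x \<le> (\<integral>\<^sup>+y. avoid A y \<partial>K x)"
proof -
  interpret prob_space "K x" by (rule prob_space_K[OF x])
  let ?g = "\<lambda>n. (killed K A ^^ n) (\<lambda>_. 1)"
  have "(\<integral>\<^sup>+y. avoid A y \<partial>K x) = (\<integral>\<^sup>+y. (INF n. ?g n y) \<partial>K x)"
    by (simp add: avoid_def)
  also have "\<dots> = (INF n. \<integral>\<^sup>+y. ?g n y \<partial>K x)"
  proof (rule nn_integral_monotone_convergence_INF_AE[where i = 0])
    show "?g n \<in> borel_measurable (K x)" for n
      using killed_funpow_measurable[OF A] by (simp add: sets_K[OF x] cong: measurable_cong_sets)
    show "AE y in K x. ?g (Suc n) y \<le> ?g n y" for n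
      using decseq_SucD[OF killed_funpow_decseq] space_K[OF x] by (intro AE_I2) metis
    show "(\<integral>\<^sup>+y. ?g 0 y \<partial>K x) < \<infinity>"
      by (simp add: emeasure_space_1)
  qed
  also have "\<dots> \<ge> avoid A x"
  proof (rule INF_greatest)
    fix n
    have "avoid A x \<le> ?g (Suc n) x"
      unfolding avoid_def by (rule INF_lower) simp
    also have "\<dots> \<le> (\<integral>\<^sup>+y. ?g n y \<partial>K x)"
      by (simp add: killed_def indicator_def)
    finally show "avoid A x \<le> (\<integral>\<^sup>+y. ?g n y \<partial>K x)" .
  qed
  finally show ?thesis .
qed

text \<open>Stationarity gives both sides the same \<open>\<pi>\<close>-integral, finite since
  \<open>\<phi>\<close> is at most 1; an almost everywhere nonnegative difference with integral zero
  vanishes almost everywhere.\<close>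

lemma AE_harmonic:
  assumes \<phi>[measurable]: "\<phi> \<in> borel_measurable S"
    and le1: "\<And>x. x \<in> space S \<Longrightarrow> \<phi> x \<le> 1"
    and sub: "AE x in \<pi>. \<phi> x \<le> (\<integral>\<^sup>+y. \<phi> y \<partial>K x)"
  shows "AE x in \<pi>. (\<integral>\<^sup>+y. \<phi> y \<partial>K x) = \<phi> x"
proof -
  interpret prob_space \<pi> by (rule prob_space_pi)
  have m: "(\<lambda>x. \<integral>\<^sup>+y. \<phi> y \<partial>K x) \<in> borel_measurable \<pi>"
    using integral_K_measurable[OF \<phi>] by (simp cong: measurable_cong_sets)
  have "(\<integral>\<^sup>+x. \<phi> x \<partial>\<pi>) \<le> (\<integral>\<^sup>+x. 1 \<partial>\<pi>)"
    using le1 by (intro nn_integral_mono) auto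
  then have "(\<integral>\<^sup>+x. \<phi> x \<partial>\<pi>) < \<infinity>"
    using emeasure_space_1 by (simp add: le_less_trans[OF _ ennreal_one_less_top])
  then have fin: "(\<integral>\<^sup>+x. \<phi> x \<partial>\<pi>) \<noteq> \<infinity>" by simp
  have "(\<integral>\<^sup>+x. (\<integral>\<^sup>+y. \<phi> y \<partial>K x) - \<phi> x \<partial>\<pi>) = 0"
    using m \<phi> sub fin
    by (subst nn_integral_diff)
      (auto simp: nn_integral_stationary[OF \<phi>] cong: measurable_cong_sets)
  then have "AE x in \<pi>. (\<integral>\<^sup>+y. \<phi> y \<partial>K x) - \<phi> x = 0"
    using m \<phi> by (subst (asm) nn_integral_0_iff_AE) (auto cong: measurable_cong_sets)
  then show ?thesis
    using sub AE_space
  proof eventually_elim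
    case (elim x)
    then show ?case
      using le1[of x] by (auto simp: diff_eq_0_iff_ennreal top_unique)
  qed
qed

text \<open>Irreducibility enters twice. Since \<open>B\<close> and \<open>D\<close> cover the
  space, one of them has positive \<open>\<psi>\<close>-measure; it cannot be \<open>D\<close>, so
  it is \<open>B\<close>, and then \<open>B\<close> has full measure.\<close>

lemma AE_avoid_eq_0:
  assumes A: "A \<in> sets S" and pos: "emeasure \<pi> A > 0"
  shows "AE x in \<pi>. avoid A x = 0"
proof -
  interpret prob_space \<pi> by (rule prob_space_pi)
  note avoid_measurable[OF A, measurable]
  obtain \<psi> where \<psi>: "sets \<psi> = sets S" "emeasure \<psi> (space \<psi>) \<noteq> 0"
    "\<And>x B. x \<in> space S \<Longrightarrow> B \<in> sets S \<Longrightarrow> emeasure \<psi> B > 0 \<Longrightarrow> hit_prob M Z B x > 0"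
    using irreducible unfolding phi_irreducible_def by blast
  define B where "B = {x \<in> space S. avoid A x = 0}"
  define D where "D = {x \<in> space S. avoid A x \<noteq> 0}"
  have [measurable]: "B \<in> sets S" "D \<in> sets S"
    unfolding B_def D_def by measurable
  have notB: "x \<in> space S \<Longrightarrow> x \<notin> B \<longleftrightarrow> x \<in> D" for x
    by (auto simp: B_def D_def)
  have "AE x in \<pi>. (\<integral>\<^sup>+y. avoid A y \<partial>K x) = avoid A x"
    using AE_space[of \<pi>] avoid_le[OF A]
    by (intro AE_harmonic avoid_measurable A avoid_le_1) (auto elim: eventually_mono)
  \<comment> \<open>Where \<open>avoid A\<close> is zero and harmonic, its
    \<open>K x\<close>-average is zero, so \<open>K x\<close> gives no mass to \<open>D\<close>, the
    set where it is positive.\<close>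
  with AE_space have D0: "AE x in \<pi>. x \<notin> D \<longrightarrow> emeasure (K x) D = 0"
  proof eventually_elim
    case (elim x)
    then have x: "x \<in> space S" by simp
    have m: "avoid A \<in> borel_measurable (K x)"
      using avoid_measurable[OF A] by (simp add: sets_K[OF x] cong: measurable_cong_sets)
    show ?case
    proof
      assume "x \<notin> D"
      with elim x have "(\<integral>\<^sup>+y. avoid A y \<partial>K x) = 0"
        by (simp add: D_def)
      then have "AE y in K x. avoid A y = 0"
        using m by (simp add: nn_integral_0_iff_AE)
      then show "emeasure (K x) D = 0"
        by (subst (asm) AE_iff_measurable[of D]) (auto simp: D_def sets_K[OF x] space_K[OF x])
    qed
  qed
  \<comment> \<open>If \<open>D\<close> could be reached from everywhere it would have full measure,
    yet it is disjoint from \<open>A\<close>, which has positive measure.\<close>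
  have "\<not> emeasure \<psi> D > 0"
  proof
    assume "emeasure \<psi> D > 0"
    then have "AE x in \<pi>. x \<in> D"
      using D0 by (intro unreachable_imp_full \<psi>) auto
    then have "AE x in \<pi>. x \<notin> A"
      by eventually_elim (auto simp: D_def avoid_in)
    then have "emeasure \<pi> A = 0"
      using A sets.sets_into_space[OF A] by (subst (asm) AE_iff_measurable[of A]) auto
    with pos show False by simp
  qed
  moreover have "emeasure \<psi> (space \<psi>) \<le> emeasure \<psi> B + emeasure \<psi> D"
  proof -
    have "space \<psi> = B \<union> D"
      using sets_eq_imp_space_eq[OF \<psi>(1)] by (auto simp: B_def D_def)
    then show ?thesis
      using emeasure_subadditive[of B \<psi> D] by (simp add: \<psi>(1))
  qed
  ultimately have B\<psi>: "emeasure \<psi> B > 0"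
    using \<psi>(2) by (auto simp: zero_less_iff_neq_zero)
  \<comment> \<open>As \<open>B\<close> is almost surely not left, its indicator is subharmonic,
    hence harmonic. Off \<open>B\<close> this says that \<open>B\<close> is not entered.\<close>
  have "AE x in \<pi>. (\<integral>\<^sup>+y. indicator B y \<partial>K x) = indicator B x"
  proof (rule AE_harmonic)
    show "AE x in \<pi>. indicator B x \<le> (\<integral>\<^sup>+y. indicator B y \<partial>K x)"
      using D0 AE_space
    proof eventually_elim
      case (elim x)
      then have x: "x \<in> space S" by simp
      interpret Kx: prob_space "K x" by (rule prob_space_K[OF x])
      show ?case
      proof (cases "x \<in> B")
        case True
        then have "emeasure (K x) D = 0"
          using elim notB[OF x] by blast
        moreover have "emeasure (K x) (space (K x)) \<le> emeasure (K x) B + emeasure (K x) D"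
        proof -
          have "space (K x) = B \<union> D"
            using space_K[OF x] by (auto simp: B_def D_def)
          then show ?thesis
            using emeasure_subadditive[of B "K x" D] by (simp add: sets_K[OF x])
        qed
        ultimately show ?thesis
          using True by (simp add: Kx.emeasure_space_1 sets_K[OF x])
      qed simp
    qed
  qed (auto simp: indicator_def)
  then have "AE x in \<pi>. x \<notin> B \<longrightarrow> emeasure (K x) B = 0"
    using AE_space by eventually_elim (auto simp: sets_K)
  then have "AE x in \<pi>. x \<in> B"
    using B\<psi> by (intro unreachable_imp_full \<psi>) auto
  then show ?thesis
    by eventually_elim (simp add: B_def)
qed

text \<open>The set where \<open>avoid A\<close> is nonzero is null, so the chain visits its
  complement \<open>B\<close> at some time \<open>n \<ge> 1\<close>. From a visit to
  \<open>B\<close> at a fixed time \<open>k\<close>, missing \<open>A\<close> forever has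
  probability zero, and there are only countably many \<open>k\<close>.\<close>

lemma harris_recurrentI:
  assumes escape: "\<And>x N. x \<in> space S \<Longrightarrow> N \<in> null_sets \<pi> \<Longrightarrow> AE w in M x. \<exists>n\<ge>1. Z n w \<notin> N"
  shows "harris_recurrent S \<pi> M Z"
  unfolding harris_recurrent_def
proof (intro ballI impI)
  fix A x assume A[measurable]: "A \<in> sets S" and pos: "emeasure \<pi> A > 0" and x: "x \<in> space S"
  interpret prob_space "M x" by (rule prob_space_M[OF x])
  note Z_measurable[OF x, measurable]
  have Zs: "Z j w \<in> space S" if "w \<in> space (M x)" for j w
    using measurable_space[OF Z_measurable[OF x] that] .
  note avoid_measurable[OF A, measurable]
  define B where "B = {x \<in> space S. avoid A x = 0}"
  define N where "N = {x \<in> space S. avoid A x \<noteq> 0}"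
  have [measurable]: "B \<in> sets S" "N \<in> sets S"
    unfolding B_def N_def by measurable
  have "emeasure \<pi> N = 0"
    using AE_avoid_eq_0[OF A pos] by (subst (asm) AE_iff_measurable[of N]) (auto simp: N_def)
  then have "N \<in> null_sets \<pi>" by (intro null_setsI) auto
  then have "AE w in M x. \<exists>n\<ge>1. Z n w \<notin> N"
    by (rule escape[OF x])
  \<comment> \<open>Missing \<open>A\<close> forever is bounded by missing it during
    \<open>n\<close> steps; as \<open>n\<close> grows the bound tends to the integral of
    \<open>avoid A\<close> over the visits to \<open>B\<close>, where it is zero.\<close>
  moreover have "AE w in M x. \<not> (Z k w \<in> B \<and> (\<forall>j\<ge>k. Z j w \<notin> A))" for k
  proof -
    let ?W = "{w \<in> space (M x). Z k w \<in> B \<and> (\<forall>j\<ge>k. Z j w \<notin> A)}"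
    let ?g = "\<lambda>n. (killed K A ^^ n) (\<lambda>_. 1)"
    have [measurable]: "?g n \<in> borel_measurable S" for n
      by (rule killed_funpow_measurable) auto
    have W: "?W \<in> sets (M x)" by measurable
    have "emeasure (M x) ?W \<le> (\<integral>\<^sup>+w. indicator B (Z k w) * ?g n (Z k w) \<partial>M x)" for n
    proof -
      have "emeasure (M x) ?W = (\<integral>\<^sup>+w. indicator ?W w \<partial>M x)"
        by (rule nn_integral_indicator[symmetric, OF W])
      also have "\<dots> \<le> (\<integral>\<^sup>+w. indicator {w. Z k w \<in> B \<and> (\<forall>j\<in>{k..<k+n}. Z j w \<notin> A)} w * 1 \<partial>M x)"
        by (intro nn_integral_mono) (auto simp: indicator_def)
      also have "\<dots> = (\<integral>\<^sup>+w. indicator B (Z k w) * ?g n (Z k w) \<partial>M x)"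
        by (rule nn_integral_killed[OF x]) auto
      finally show ?thesis .
    qed
    then have "emeasure (M x) ?W \<le> (INF n. \<integral>\<^sup>+w. indicator B (Z k w) * ?g n (Z k w) \<partial>M x)"
      by (intro INF_greatest)
    also have "\<dots> = (\<integral>\<^sup>+w. (INF n. indicator B (Z k w) * ?g n (Z k w)) \<partial>M x)"
    proof (rule nn_integral_monotone_convergence_INF_AE[symmetric, where i = 0])
      show "AE w in M x. indicator B (Z k w) * ?g (Suc n) (Z k w) \<le> indicator B (Z k w) * ?g n (Z k w)" for n
        using decseq_SucD[OF killed_funpow_decseq[OF Zs]]
        by (intro AE_I2 mult_left_mono) (blast, simp)
      have "(\<integral>\<^sup>+w. indicator B (Z k w) * ?g 0 (Z k w) \<partial>M x) \<le> (\<integral>\<^sup>+w. 1 \<partial>M x)"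
        by (intro nn_integral_mono) (auto simp: indicator_def)
      then show "(\<integral>\<^sup>+w. indicator B (Z k w) * ?g 0 (Z k w) \<partial>M x) < \<infinity>"
        by (simp add: emeasure_space_1 le_less_trans[OF _ ennreal_one_less_top])
    qed measurable
    also have "\<dots> = (\<integral>\<^sup>+w. 0 \<partial>M x)"
    proof (rule nn_integral_cong)
      fix w
      show "(INF n. indicator B (Z k w) * ?g n (Z k w)) = 0"
      proof (cases "Z k w \<in> B")
        case True
        then show ?thesis by (simp add: B_def avoid_def)
      qed simp
    qed
    finally have "emeasure (M x) ?W = 0" by simp
    then show ?thesis
      using W by (subst AE_iff_measurable[of ?W]) auto
  qed
  then have "AE w in M x. \<forall>k. \<not> (Z k w \<in> B \<and> (\<forall>j\<ge>k. Z j w \<notin> A))"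
    by (simp add: AE_all_countable)
  ultimately have "AE w in M x. \<exists>n\<ge>1. Z n w \<in> A"
    using AE_space
  proof eventually_elim
    case (elim w)
    then obtain n where "n \<ge> 1" "Z n w \<notin> N" by blast
    with Zs[of w n] elim have "Z n w \<in> B"
      by (auto simp: B_def N_def)
    with elim obtain j where "j \<ge> n" "Z j w \<in> A" by blast
    with \<open>n \<ge> 1\<close> show ?case by (meson le_trans)
  qed
  then show "hit_prob M Z A x = 1"
    unfolding hit_prob_def hitting_time_finite_iff by (subst prob_Collect_eq_1) auto
qed

end

section \<open>Absolute continuity after moving in every direction\<close>

lemma upd_nth: "upd i x z $ j = (if j = i then z else x $ j)"
  by (simp add: upd_def)

text \<open>Writing an update as a translation along an axis makes translation invariance of
  Lebesgue measure available.\<close>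

lemma upd_eq_add: "upd i x (x $ i + s) = s *\<^sub>R axis i 1 + x"
  by (simp add: vec_eq_iff upd_nth axis_def)

lemma upd_eq: "upd i x z = (z - x $ i) *\<^sub>R axis i 1 + x"
  using upd_eq_add[of i x "z - x $ i"] by simp

lemma vec_nth_borel_measurable[measurable]: "(\<lambda>x::real^'n. x $ i) \<in> borel_measurable borel"
  by (intro borel_measurable_continuous_onI continuous_intros)

lemma upd_borel_measurable[measurable (raw)]:
  fixes g :: "'b \<Rightarrow> real ^ 'n"
  assumes [measurable]: "g \<in> borel_measurable N" "h \<in> borel_measurable N"
  shows "(\<lambda>w. upd i (g w) (h w)) \<in> borel_measurable N"
proof -
  have [measurable]: "(\<lambda>w. g w $ i) \<in> borel_measurable N"
    by (rule measurable_compose[OF assms(1) vec_nth_borel_measurable])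
  show ?thesis unfolding upd_eq by measurable
qed

text \<open>Coordinates outside \<open>J\<close> stay frozen at the start \<open>x\<close>. Letting
  \<open>z\<close> range over the full space up to null sets expresses absolute continuity in the
  \<open>J\<close>-coordinates without introducing Lebesgue measure on a subspace.\<close>

definition mix :: "'n set \<Rightarrow> real ^ 'n \<Rightarrow> real ^ 'n \<Rightarrow> real ^ 'n" where
  "mix J x z = (\<chi> j. if j \<in> J then z $ j else x $ j)"

lemma mix_empty: "mix {} x z = x"
  by (simp add: mix_def)

lemma mix_UNIV: "mix UNIV x z = z"
  by (simp add: mix_def)

text \<open>Valid whether or not \<open>i\<close> is already in \<open>J\<close>, so repeated moves
  in one direction need no separate case.\<close>

lemma mix_insert_upd: "mix (insert i J) x (upd i z t) = upd i (mix J x z) t"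
  by (simp add: mix_def vec_eq_iff upd_nth)

lemma mix_borel_measurable[measurable]: "mix J x \<in> borel_measurable borel"
proof (rule borel_measurable_continuous_onI)
  have "continuous_on UNIV (\<lambda>z. if j \<in> J then z $ j else x $ j)" for j
    by (cases "j \<in> J") (auto intro!: continuous_intros)
  then show "continuous_on UNIV (mix J x)"
    unfolding mix_def[abs_def] by (intro continuous_on_vec_lambda)
qed

lemma AE_lborel_translate:
  fixes c :: "'a::euclidean_space"
  assumes "B \<in> sets borel"
  shows "(AE z in lborel. c + z \<notin> B) \<longleftrightarrow> (AE z in lborel. z \<notin> B)"
proof -
  have "(AE z in distr lborel borel ((+) c). z \<notin> B) \<longleftrightarrow> (AE z in lborel. c + z \<notin> B)"
    using assms by (intro AE_distr_iff) auto
  then show ?thesis unfolding lborel_distr_plus by (rule sym)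
qed

text \<open>
  A form of Fubini's theorem that needs no product decomposition of \<open>real ^ 'n\<close>: the pairs
  \<open>(z, s)\<close> with \<open>z\<close> translated by \<open>s\<close> along the axis into a null set form a null set.
\<close>

lemma AE_lborel_slices:
  fixes B :: "(real ^ 'n) set"
  assumes B[measurable]: "B \<in> sets borel" and null: "AE z in lborel. z \<notin> B"
  shows "AE z in lborel. AE t in lborel. upd i z t \<notin> B"
proof -
  have "AE s in lborel. AE z in lborel. s *\<^sub>R axis i 1 + z \<notin> B"
    using null by (simp add: AE_lborel_translate[OF B])
  then have "AE z in lborel. AE s in lborel. s *\<^sub>R axis i 1 + z \<notin> B"
    by (subst (asm) lborel_pair.AE_commute) measurable
  then show ?thesis
  proof eventually_elim
    case (elim z)
    \<comment> \<open>Translation invariance again, now on the real line, for the substitution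
      \<open>t = z $ i + s\<close>.\<close>
    have "{t. upd i z t \<in> B} \<in> sets borel" by measurable
    from AE_lborel_translate[OF this, of "z $ i"] elim show ?case
      by (simp add: upd_eq_add)
  qed
qed

section \<open>The proposal and acceptance kernel, and null sets of the target\<close>

lemma accept_prob_nonneg:
  assumes "\<And>x. x \<in> \<X> \<Longrightarrow> 0 < f x" "\<And>i x z. x \<in> \<X> \<Longrightarrow> 0 \<le> q i x z" "x \<in> \<X>"
  shows "0 \<le> accept_prob \<X> f q i x y"
  using assms by (auto simp: accept_prob_def less_imp_le intro!: divide_nonneg_nonneg mult_nonneg_nonneg)

lemma accept_prob_le_1: "accept_prob \<X> f q i x y \<le> 1"
  by (simp add: accept_prob_def)

context
  fixes \<X> :: "(real ^ 'n) set" and f :: "real ^ 'n \<Rightarrow> real"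
    and q :: "'n \<Rightarrow> real ^ 'n \<Rightarrow> real \<Rightarrow> real"
  assumes setting: "mwg_setting \<X> f q"
begin

lemma X_borel[measurable]: "\<X> \<in> sets borel"
  using setting by (simp add: mwg_setting_def)

lemma q_measurable:
  "g \<in> N \<rightarrow>\<^sub>M states \<X> \<Longrightarrow> h \<in> borel_measurable N \<Longrightarrow> (\<lambda>w. q i (g w) (h w)) \<in> borel_measurable N"
  using setting measurable_compose[OF measurable_Pair, of g N "states \<X>" h borel "\<lambda>(x, z). q i x z" borel]
  by (simp add: mwg_setting_def)

lemma accept_prob_measurable:
  assumes x: "x \<in> \<X>"
  shows "accept_prob \<X> f q i x \<in> borel_measurable borel"
proof -
  \<comment> \<open>\<open>f\<close> and \<open>q i\<close> are controlled only on
    \<open>\<X>\<close>. Cutting them off outside gives Borel functions on the whole space and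
    leaves the acceptance probability unchanged, as it is 0 there.\<close>
  have [measurable]: "(\<lambda>y. indicator \<X> y *\<^sub>R f y) \<in> borel_measurable borel"
    using setting borel_measurable_integrable[of lborel "\<lambda>y. indicator \<X> y *\<^sub>R f y"]
    by (simp add: mwg_setting_def set_integrable_def)
  have [measurable]: "(\<lambda>y. indicator \<X> y *\<^sub>R q i y (x $ i)) \<in> borel_measurable borel"
    using q_measurable[of "\<lambda>y. y" "states \<X>" "\<lambda>_. x $ i" i]
    by (subst borel_measurable_restrict_space_iff[symmetric]) auto
  have [measurable]: "(\<lambda>y. q i x (y $ i)) \<in> borel_measurable borel"
    using x by (intro q_measurable) (auto simp: space_restrict_space)
  have "accept_prob \<X> f q i x = (\<lambda>y. if y \<notin> \<X> then 0 else if f x * q i x (y $ i) = 0 then 1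
      else min 1 (((indicator \<X> y *\<^sub>R f y) * (indicator \<X> y *\<^sub>R q i y (x $ i))) / (f x * q i x (y $ i))))"
    by (auto simp: accept_prob_def fun_eq_iff)
  also have "\<dots> \<in> borel_measurable borel"
    by measurable
  finally show ?thesis .
qed

lemma accept_flag_measurable:
  assumes x: "x \<in> \<X>"
  shows "(\<lambda>y. distr (measure_pmf (bernoulli_pmf (accept_prob \<X> f q i x y)))
      (borel \<Otimes>\<^sub>M count_space UNIV) (\<lambda>b. (y, b)))
    \<in> borel \<rightarrow>\<^sub>M subprob_algebra (borel \<Otimes>\<^sub>M count_space UNIV)"
proof (rule measurable_distr2[where M = "count_space UNIV"])
  note accept_prob_measurable[OF x, measurable]
  have nonneg: "0 \<le> accept_prob \<X> f q i x y" for y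
    using setting x by (intro accept_prob_nonneg) (auto simp: mwg_setting_def)
  show "(\<lambda>y. measure_pmf (bernoulli_pmf (accept_prob \<X> f q i x y)))
      \<in> borel \<rightarrow>\<^sub>M subprob_algebra (count_space UNIV)"
  proof (rule measurable_subprob_algebra)
    fix C :: "bool set"
    have "emeasure (measure_pmf (bernoulli_pmf (accept_prob \<X> f q i x y))) C =
        (\<Sum>b\<in>C. ennreal (if b then accept_prob \<X> f q i x y else 1 - accept_prob \<X> f q i x y))" for y
      unfolding emeasure_measure_pmf_finite[OF finite] sum_ennreal[OF pmf_nonneg, symmetric]
      using nonneg[of y] accept_prob_le_1[of \<X> f q i x y] by (intro sum.cong) auto
    then show "(\<lambda>y. emeasure (measure_pmf (bernoulli_pmf (accept_prob \<X> f q i x y))) C)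
        \<in> borel_measurable borel"
      by simp
  qed (auto intro: prob_space_imp_subprob_space measure_pmf.prob_space_axioms)
qed measurable

text \<open>The proposal has a density along the line through \<open>x\<close> in direction
  \<open>i\<close>, so a set that is null on this line is almost surely not proposed, let alone
  accepted.\<close>

lemma propose_accept_null:
  assumes x: "x \<in> \<X>" and N[measurable]: "N \<in> sets borel"
    and null: "AE t in lborel. upd i x t \<notin> N"
  shows "emeasure (propose_accept \<X> f q i x) (N \<times> {True}) = 0"
proof -
  have [measurable]: "q i x \<in> borel_measurable borel"
    using x by (intro q_measurable) (auto simp: space_restrict_space)
  have [simp]: "sets (proposal q i x) = sets borel" "space (proposal q i x) = UNIV"
    by (simp_all add: proposal_def)
  have "AE y in proposal q i x. y \<notin> N"
    unfolding proposal_def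
    by (subst AE_distr_iff) (use null in \<open>auto simp: AE_density\<close>)
  moreover have "emeasure (propose_accept \<X> f q i x) (N \<times> {True}) =
     (\<integral>\<^sup>+y. emeasure (distr (measure_pmf (bernoulli_pmf (accept_prob \<X> f q i x y)))
                  (borel \<Otimes>\<^sub>M count_space UNIV) (\<lambda>b. (y, b))) (N \<times> {True}) \<partial>proposal q i x)"
    unfolding propose_accept_def
    by (rule emeasure_bind[where N = "borel \<Otimes>\<^sub>M count_space UNIV"])
      (use accept_flag_measurable[OF x] in \<open>auto cong: measurable_cong_sets\<close>)
  moreover have "(\<integral>\<^sup>+y. emeasure (distr (measure_pmf (bernoulli_pmf (accept_prob \<X> f q i x y)))
                  (borel \<Otimes>\<^sub>M count_space UNIV) (\<lambda>b. (y, b))) (N \<times> {True}) \<partial>proposal q i x)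
      = (\<integral>\<^sup>+y. 0 \<partial>proposal q i x)"
    using calculation(1)
  proof (intro nn_integral_cong_AE, eventually_elim)
    case (elim y)
    then have "(\<lambda>b. (y, b)) -` (N \<times> {True}) = {}" by auto
    then show ?case by (subst emeasure_distr) (auto simp: space_pair_measure)
  qed
  ultimately show ?thesis by simp
qed

text \<open>The target density is strictly positive on \<open>\<X>\<close>, so Lebesgue measure on
  \<open>\<X>\<close> is absolutely continuous with respect to the target.\<close>

lemma null_sets_target:
  assumes "prob_space (target \<X> f)" and N: "N \<in> null_sets (target \<X> f)"
  shows "N \<in> sets borel" "AE z in lborel. z \<notin> N"
proof -
  interpret prob_space "target \<X> f" by fact
  let ?c = "LINT y:\<X>|lborel. f y"
  have f: "set_integrable lborel \<X> f" "\<And>x. x \<in> \<X> \<Longrightarrow> 0 < f x"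
    using setting by (auto simp: mwg_setting_def)
  have [measurable]: "f \<in> borel_measurable (restrict_space lborel \<X>)"
    using f(1) by (subst borel_measurable_restrict_space_iff)
      (auto simp: set_integrable_def borel_measurable_integrable)
  have "0 \<le> ?c"
    unfolding set_lebesgue_integral_def
    using f(2) by (intro integral_nonneg_AE AE_I2) (auto simp: indicator_def less_imp_le)
  \<comment> \<open>Division by zero yields 0, so \<open>?c = 0\<close> would turn the target into
    the zero measure.\<close>
  moreover have "?c \<noteq> 0"
  proof
    assume "?c = 0"
    then have "emeasure (target \<X> f) (space (target \<X> f)) = 0"
      unfolding target_def by (subst emeasure_density) (auto simp: sets_restrict_space_iff)
    then show False by (simp add: emeasure_space_1)
  qed
  ultimately have c: "0 < ?c" by simp
  have N': "N \<in> sets (restrict_space lborel \<X>)"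
    using N by (auto simp: target_def)
  then show "N \<in> sets borel"
    by (subst (asm) sets_restrict_space_iff) auto
  have "N \<subseteq> \<X>"
    using sets.sets_into_space[OF N'] by (simp add: space_restrict_space)
  have "AE z in target \<X> f. z \<notin> N"
    using N by (rule AE_not_in)
  then have "AE z in restrict_space lborel \<X>. 0 < ennreal (f z / ?c) \<longrightarrow> z \<notin> N"
    unfolding target_def by (subst (asm) AE_density) auto
  then have "AE z in lborel. z \<in> \<X> \<longrightarrow> 0 < ennreal (f z / ?c) \<longrightarrow> z \<notin> N"
    by (subst (asm) AE_restrict_space_iff) auto
  then show "AE z in lborel. z \<notin> N"
    by eventually_elim (use f(2) c \<open>N \<subseteq> \<X>\<close> in auto)
qed

end

section \<open>The state given the set of directions moved in so far\<close>

definition moved :: "(nat \<Rightarrow> 'n) \<Rightarrow> (nat \<Rightarrow> bool) \<Rightarrow> nat \<Rightarrow> 'n set" where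
  "moved is as n = {i. \<exists>k\<in>{1..n}. as k \<and> is k = i}"

lemma moved_0: "moved is as 0 = {}"
  by (simp add: moved_def)

lemma moved_Suc:
  "moved is as (Suc n) = (if as (Suc n) then insert (is (Suc n)) (moved is as n) else moved is as n)"
  by (auto simp: moved_def atLeastAtMostSuc_conv)

lemma moved_cong:
  "(\<And>k. k \<in> {1..n} \<Longrightarrow> is k = is' k \<and> as k = as' k) \<Longrightarrow> moved is as n = moved is' as' n"
  unfolding moved_def by auto

text \<open>
  On the event that exactly the directions in \<open>J\<close> have been moved in, the law of the current state
  has all coordinates outside \<open>J\<close> frozen and those in \<open>J\<close> jointly absolutely continuous.
\<close>

lemma AE_moved_not_in_null:
  fixes \<X> :: "(real ^ 'n) set"
  assumes setting: "mwg_setting \<X> f q" and process: "mwg_process \<X> f q M X I Y acc"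
    and x: "x \<in> \<X>" and N: "N \<in> sets borel" and null: "AE z in lborel. mix J x z \<notin> N"
  shows "AE w in M x. moved (\<lambda>k. I k w) (\<lambda>k. acc k w) n = J \<longrightarrow> X n w \<notin> N"
  using N null
proof (induction n arbitrary: J N)
  case 0
  have "AE w in M x. X 0 w = x"
    using process x by (simp add: mwg_process_def)
  \<comment> \<open>With nothing moved, \<open>mix\<close> is constantly \<open>x\<close>, and
    Lebesgue measure is not the zero measure.\<close>
  moreover have "x \<notin> N" if "J = {}"
  proof -
    have "AE z in lborel :: (real ^ 'n) measure. x \<notin> N"
      using 0 that by (simp add: mix_empty)
    then show ?thesis
      by (simp add: AE_iff_measurable[OF _ refl] split: if_splits)
  qed
  ultimately show ?case
    by (auto simp: moved_0 elim: eventually_mono)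
next
  case (Suc n)
  note N[measurable] = Suc.prems(1)
  let ?M1 = "\<Pi>\<^sub>M k\<in>{..n}. states \<X>"
  let ?M2 = "\<Pi>\<^sub>M k\<in>{1..n}. (borel :: (real ^ 'n) measure) \<Otimes>\<^sub>M (count_space UNIV :: bool measure)"
  let ?M3 = "\<Pi>\<^sub>M k\<in>{1..Suc n}. (count_space UNIV :: 'n measure)"
  let ?MH = "?M1 \<Otimes>\<^sub>M ?M2 \<Otimes>\<^sub>M ?M3"
  let ?H = "\<lambda>w. (\<lambda>k\<in>{..n}. X k w, \<lambda>k\<in>{1..n}. (Y k w, acc k w), \<lambda>k\<in>{1..Suc n}. I k w)"
  let ?mv = "\<lambda>w. moved (\<lambda>k. I k w) (\<lambda>k. acc k w) n"
  have law: "cond_law (M x) ?H ?MH (\<lambda>w. (Y (Suc n) w, acc (Suc n) w)) (borel \<Otimes>\<^sub>M count_space UNIV)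
      (\<lambda>(xs, ys, is). propose_accept \<X> f q (is (Suc n)) (xs n))"
    and step: "AE w in M x. X (Suc n) w = (if acc (Suc n) w then Y (Suc n) w else X n w)"
    using process x unfolding mwg_process_def by blast+
  have H: "?H \<in> M x \<rightarrow>\<^sub>M ?MH"
    and [measurable]: "(\<lambda>w. (Y (Suc n) w, acc (Suc n) w)) \<in> M x \<rightarrow>\<^sub>M borel \<Otimes>\<^sub>M count_space UNIV"
    using law by (auto simp: cond_law_def)
  have Xn: "X n w \<in> \<X>" if "w \<in> space (M x)" for w
    using measurable_space[OF H that] by (auto simp: space_pair_measure space_PiM space_restrict_space)
  \<comment> \<open>The case of an accepted move in direction \<open>i\<close> that turns
    \<open>J'\<close> into \<open>J\<close>; \<open>J' = J\<close> is possible.\<close>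
  have accepted: "AE w in M x. \<not> (?mv w = J' \<and> I (Suc n) w = i \<and> Y (Suc n) w \<in> N \<and> acc (Suc n) w)"
    if J: "J = insert i J'" for J' i
  proof -
    \<comment> \<open>The states whose line in direction \<open>i\<close> meets \<open>N\<close> in
      positive length. Off \<open>N'\<close> an accepted move almost surely misses \<open>N\<close>,
      so the induction hypothesis is applied to \<open>J'\<close> and \<open>N'\<close>.\<close>
    define N' where "N' = {x'. emeasure lborel {t. upd i x' t \<in> N} \<noteq> 0}"
    have null_iff: "x' \<notin> N' \<longleftrightarrow> (AE t in lborel. upd i x' t \<notin> N)" for x'
    proof -
      have "{t. upd i x' t \<in> N} \<in> sets lborel" by measurable
      then show ?thesis
        by (subst AE_iff_measurable[of "{t. upd i x' t \<in> N}"]) (auto simp: N'_def)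
    qed
    have [measurable]: "N' \<in> sets borel"
    proof -
      have "(\<lambda>x'. \<integral>\<^sup>+t. indicator N (upd i x' t) \<partial>lborel) \<in> borel_measurable borel"
        by measurable
      moreover have "(\<integral>\<^sup>+t. indicator N (upd i x' t) \<partial>lborel) = emeasure lborel {t. upd i x' t \<in> N}" for x'
      proof -
        have slice: "{t. upd i x' t \<in> N} \<in> sets lborel" by measurable
        show ?thesis
          unfolding nn_integral_indicator[OF slice, symmetric]
          by (intro nn_integral_cong) (auto split: split_indicator)
      qed
      ultimately have [measurable]: "(\<lambda>x'. emeasure lborel {t. upd i x' t \<in> N}) \<in> borel_measurable borel"
        by simp
      show ?thesis unfolding N'_def by measurable
    qed
    \<comment> \<open>Almost all slices of the null preimage of \<open>N\<close> under
      \<open>mix J x\<close> are null; \<open>mix_insert_upd\<close> identifies them with slices of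
      \<open>N\<close> through \<open>mix J' x z\<close>.\<close>
    have "AE z in lborel. mix J' x z \<notin> N'"
    proof -
      have "{z. mix J x z \<in> N} \<in> sets borel" by measurable
      from AE_lborel_slices[OF this, of i] show ?thesis
        using Suc.prems(2) by (simp add: null_iff J mix_insert_upd)
    qed
    then have IH: "AE w in M x. ?mv w = J' \<longrightarrow> X n w \<notin> N'"
      by (intro Suc.IH) auto
    define E where "E = {h \<in> space ?MH.
      moved (snd (snd h)) (\<lambda>k. snd (fst (snd h) k)) n = J' \<and> snd (snd h) (Suc n) = i}"
    have E: "E \<in> sets ?MH"
    proof -
      have [measurable]: "(\<lambda>h. snd (snd h) k) \<in> ?MH \<rightarrow>\<^sub>M count_space UNIV" if "k \<in> {1..Suc n}" for k
        using that by measurable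
      have [measurable]: "(\<lambda>h. snd (fst (snd h) k)) \<in> ?MH \<rightarrow>\<^sub>M count_space UNIV" if "k \<in> {1..n}" for k
        using that by measurable
      \<comment> \<open>Set equality is spelled out over the finitely many directions to make
        measurability visible.\<close>
      have "E = {h \<in> space ?MH. (\<forall>j\<in>UNIV. (\<exists>k\<in>{1..n}. snd (fst (snd h) k) \<and> snd (snd h) k = j) \<longleftrightarrow> j \<in> J')
          \<and> snd (snd h) (Suc n) = i}"
        unfolding E_def moved_def by (intro Collect_cong) blast
      also have "\<dots> \<in> sets ?MH" by measurable
      finally show ?thesis .
    qed
    have HE: "?H w \<in> E \<longleftrightarrow> ?mv w = J' \<and> I (Suc n) w = i" if "w \<in> space (M x)" for w
    proof -
      have "moved (\<lambda>k\<in>{1..Suc n}. I k w) (\<lambda>k. snd ((\<lambda>k\<in>{1..n}. (Y k w, acc k w)) k)) n = ?mv w"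
        by (rule moved_cong) auto
      then show ?thesis
        using measurable_space[OF H that] by (simp add: E_def)
    qed
    let ?C = "N \<times> {True}"
    have C: "?C \<in> sets (borel \<Otimes>\<^sub>M count_space UNIV)" by measurable
    let ?W = "{w \<in> space (M x). ?H w \<in> E \<and> (Y (Suc n) w, acc (Suc n) w) \<in> ?C}"
    have W: "?W \<in> sets (M x)"
      using H E C by measurable
    have "emeasure (M x) ?W = (\<integral>\<^sup>+w. indicator E (?H w) *
        emeasure ((\<lambda>(xs, ys, is). propose_accept \<X> f q (is (Suc n)) (xs n)) (?H w)) ?C \<partial>M x)"
      using law E C unfolding cond_law_def by blast
    also have "\<dots> = (\<integral>\<^sup>+w. 0 \<partial>M x)"
    proof (rule nn_integral_cong_AE)
      show "AE w in M x. indicator E (?H w) *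
        emeasure ((\<lambda>(xs, ys, is). propose_accept \<X> f q (is (Suc n)) (xs n)) (?H w)) ?C = 0"
        using IH AE_space
      proof eventually_elim
        case (elim w)
        show ?case
        proof (cases "?H w \<in> E")
          case True
          then have "?mv w = J'" "I (Suc n) w = i"
            using HE elim by auto
          then have "AE t in lborel. upd i (X n w) t \<notin> N"
            using elim null_iff by blast
          then have "emeasure (propose_accept \<X> f q i (X n w)) ?C = 0"
            using elim by (intro propose_accept_null[OF setting] Xn) auto
          then show ?thesis
            using \<open>I (Suc n) w = i\<close> by simp
        qed simp
      qed
    qed
    finally have "emeasure (M x) ?W = 0" by simp
    then have "AE w in M x. w \<notin> ?W"
      using W by (intro AE_not_in null_setsI)
    then show ?thesis
      using AE_space by eventually_elim (use HE in auto)
  qed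
  \<comment> \<open>Only finitely many pairs of a last direction and a previous set lead to
    \<open>J\<close>.\<close>
  have "AE w in M x. \<forall>i\<in>UNIV. \<forall>J'\<in>UNIV. J = insert i J' \<longrightarrow>
      \<not> (?mv w = J' \<and> I (Suc n) w = i \<and> Y (Suc n) w \<in> N \<and> acc (Suc n) w)"
  proof (intro AE_finite_allI finite)
    fix i J'
    show "AE w in M x. J = insert i J' \<longrightarrow>
      \<not> (?mv w = J' \<and> I (Suc n) w = i \<and> Y (Suc n) w \<in> N \<and> acc (Suc n) w)"
      using accepted[of i J'] by (cases "J = insert i J'") auto
  qed
  \<comment> \<open>After a rejection both the state and the set of moved directions
    persist.\<close>
  moreover have "AE w in M x. ?mv w = J \<longrightarrow> X n w \<notin> N"
    by (rule Suc.IH[OF Suc.prems])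
  ultimately show ?case
    using step by eventually_elim (auto simp: moved_Suc)
qed

theorem theorem12:
  fixes \<X> :: "(real ^ 'n) set"
    and f :: "real ^ 'n \<Rightarrow> real"
    and q :: "'n \<Rightarrow> real ^ 'n \<Rightarrow> real \<Rightarrow> real"
    and M :: "real ^ 'n \<Rightarrow> 'w measure"
    and X Y :: "nat \<Rightarrow> 'w \<Rightarrow> real ^ 'n"
    and I :: "nat \<Rightarrow> 'w \<Rightarrow> 'n"
    and acc :: "nat \<Rightarrow> 'w \<Rightarrow> bool"
    and K :: "real ^ 'n \<Rightarrow> (real ^ 'n) measure"
    and m :: nat
  assumes setting: "mwg_setting \<X> f q"
    and process: "mwg_process \<X> f q M X I Y acc"
    and m_pos: "1 \<le> m"
    \<comment> \<open>the chain is observed every \<open>m\<close> coordinate updates: \<open>m = 1\<close> for the random scan,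
        \<open>m = CARD('n)\<close> for complete sweeps of the deterministic scan\<close>
    and markov: "markov_chain (states \<X>) K M (\<lambda>n. X (m * n))"
    and stationary: "stationary_distribution (states \<X>) K (target \<X> f)"
    and irreducible: "phi_irreducible (states \<X>) M (\<lambda>n. X (m * n))"
    and eventually_moves:
      "\<And>x. x \<in> \<X> \<Longrightarrow> AE w in M x. \<forall>i. \<exists>n. moves_in_direction I acc i n w"
  shows "harris_recurrent (states \<X>) (target \<X> f) M (\<lambda>n. X (m * n))"
proof -
  interpret stationary_chain "states \<X>" K M "\<lambda>n. X (m * n)" "target \<X> f"
    using markov stationary irreducible by unfold_locales
  show ?thesis
  proof (rule harris_recurrentI)
    fix x N
    assume "x \<in> space (states \<X>)" and N: "N \<in> null_sets (target \<X> f)"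
    then have x: "x \<in> \<X>" by (simp add: space_restrict_space)
    let ?mv = "\<lambda>w n. moved (\<lambda>k. I k w) (\<lambda>k. acc k w) n"
    note N = null_sets_target[OF setting prob_space_pi N]
    have "AE w in M x. ?mv w n = UNIV \<longrightarrow> X n w \<notin> N" for n
      using N by (intro AE_moved_not_in_null[OF setting process x]) (simp_all add: mix_UNIV)
    then have "AE w in M x. \<forall>n. ?mv w n = UNIV \<longrightarrow> X n w \<notin> N"
      unfolding AE_all_countable by blast
    with eventually_moves[OF x] show "AE w in M x. \<exists>n\<ge>1. X (m * n) w \<notin> N"
    proof eventually_elim
      case (elim w)
      then obtain n where n: "\<And>i. moves_in_direction I acc i (n i) w"
        by metis
      \<comment> \<open>Counted in observation times: as \<open>m \<ge> 1\<close>, all the chosen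
        moves have occurred by the update \<open>m * n0\<close>.\<close>
      define n0 where "n0 = Max (range n)"
      have le: "n i \<le> m * n0" for i
      proof -
        have "n i \<le> n0" unfolding n0_def by (intro Max_ge) auto
        also have "n0 \<le> m * n0" using m_pos by simp
        finally show ?thesis .
      qed
      then have "?mv w (m * n0) = UNIV"
        using n unfolding moved_def moves_in_direction_def by fastforce
      \<comment> \<open>Moves carry an index of at least 1, which excludes
        \<open>n0 = 0\<close>.\<close>
      moreover have "1 \<le> n0"
        using n[of undefined] le[of undefined] by (cases n0) (auto simp: moves_in_direction_def)
      ultimately show ?case
        using elim(2) by blast
    qed
  qed
qed

end
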